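(* Let $r\geqslant 3$ and let $H$ be a connected $r$-uniform hypergraph on $n$ vertices with vertex set $[n]=\{1,2,\ldots,n\}$. For $i\in[n]$ let $d_i$ be the degree of vertex $i$ in $H$, and let $\rho(\mathcal{Q}(H))$ be the spectral radius of the signless Laplacian tensor $\mathcal{Q}(H)$. Then $$\rho(\mathcal{Q}(H))\geqslant 2\left(\frac{1}{n}\sum_{i=1}^n d_i^{\frac{r}{r-1}}\right)^{\frac{r-1}{r}},$$ with equality if and only if $H$ is regular.
   Context: A hypergraph $H=(V,E)$ consists of a finite set $V$ of vertices and a set $E$ of non-empty subsets of $V$, called edges. It is $r$-uniform if every edge has exactly $r$ elements. The degree $d_i$ of a vertex $i$ is the number of edges containing $i$; $H$ is regular if all vertices have the same degree. A walk is an alternating sequence of vertices and edges $i_1e_1i_2e_2\cdots i_\ell e_\ell i_{\ell+1}$ with $\{i_j,i_{j+1}\}\subseteq e_j\in E$ for $1\leqslant j\leqslant \ell$; $H$ is connected if for any vertices $i,j$ there is a walk connecting $i$ and $j$. A real tensor of order $r$ and dimension $n$ is an array $\mathcal{T}=(t_{i_1i_2\cdots i_r})$ of real numbers indexed by $i_1,\ldots,i_r\in[n]$. For $\boldsymbol{x}=(x_1,\ldots,x_n)^{\mathrm{T}}\in\mathbb{C}^n$, $\mathcal{T}\boldsymbol{x}\in\mathbb{C}^n$ is the vector with components $(\mathcal{T}\boldsymbol{x})_i=\sum_{i_2,\ldots,i_r=1}^n t_{ii_2\cdots i_r}x_{i_2}\cdots x_{i_r}$, and $\boldsymbol{x}^{[r-1]}=(x_1^{r-1},\ldots,x_n^{r-1})^{\mathrm{T}}$.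 A number $\lambda\in\mathbb{C}$ is an eigenvalue of $\mathcal{T}$ if there is a nonzero $\boldsymbol{x}\in\mathbb{C}^n$ with $\mathcal{T}\boldsymbol{x}=\lambda\boldsymbol{x}^{[r-1]}$. The spectral radius $\rho(\mathcal{T})$ is the maximum modulus of the eigenvalues of $\mathcal{T}$. The adjacency tensor of an $r$-uniform hypergraph $H$ with vertex set $[n]$ is the order $r$, dimension $n$ tensor $\mathcal{A}(H)=(a_{i_1i_2\cdots i_r})$ with $a_{i_1i_2\cdots i_r}=\frac{1}{(r-1)!}$ if $\{i_1,i_2,\ldots,i_r\}\in E(H)$, and $a_{i_1i_2\cdots i_r}=0$ otherwise. Let $\mathcal{D}(H)$ be the order $r$, dimension $n$ diagonal tensor whose diagonal entry with all indices equal to $i$ is $d_i$ for each $i\in[n]$, all other entries being $0$. The signless Laplacian tensor of $H$ is $\mathcal{Q}(H)=\mathcal{D}(H)+\mathcal{A}(H)$ (entrywise sum). *)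

theory Defs
  imports Complex_Main
begin

section \<open>Hypergraphs\<close>

definition hypergraph :: "'a set \<Rightarrow> 'a set set \<Rightarrow> bool" where
  "hypergraph V E \<longleftrightarrow> finite V \<and> (\<forall>e\<in>E. e \<noteq> {} \<and> e \<subseteq> V)"

definition uniform_hypergraph :: "nat \<Rightarrow> 'a set set \<Rightarrow> bool" where
  "uniform_hypergraph r E \<longleftrightarrow> (\<forall>e\<in>E. card e = r)"

definition hdegree :: "'a set set \<Rightarrow> 'a \<Rightarrow> nat" where
  "hdegree E i = card {e \<in> E. i \<in> e}"

definition regular_hypergraph :: "'a set \<Rightarrow> 'a set set \<Rightarrow> bool" where
  "regular_hypergraph V E \<longleftrightarrow> (\<forall>i\<in>V. \<forall>j\<in>V. hdegree E i = hdegree E j)"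

text \<open>
  A walk is given by its list of vertices and its list of edges. The walk with no edges is
  allowed, so a hypergraph with a single vertex is connected.
\<close>

definition walk :: "'a set \<Rightarrow> 'a set set \<Rightarrow> 'a list \<Rightarrow> 'a set list \<Rightarrow> bool" where
  "walk V E vs es \<longleftrightarrow>
     length vs = length es + 1 \<and> set vs \<subseteq> V \<and> set es \<subseteq> E \<and>
     (\<forall>k<length es. {vs ! k, vs ! (k + 1)} \<subseteq> es ! k)"

definition connected_hypergraph :: "'a set \<Rightarrow> 'a set set \<Rightarrow> bool" where
  "connected_hypergraph V E \<longleftrightarrow>
     (\<forall>i\<in>V. \<forall>j\<in>V. \<exists>vs es. walk V E vs es \<and> hd vs = i \<and> last vs = j)"

section \<open>Tensors and their eigenvalues\<close>

text \<open>
  A real tensor of order \<open>r\<close> and dimension \<open>n\<close> is represented by a function on index lists; only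
  its values on lists of length \<open>r\<close> with entries in \<open>{1..n}\<close> matter. Likewise a vector of
  dimension \<open>n\<close> is a function of which only the values on \<open>{1..n}\<close> matter.
\<close>

type_synonym tensor = "nat list \<Rightarrow> real"

definition tensor_apply :: "nat \<Rightarrow> nat \<Rightarrow> tensor \<Rightarrow> (nat \<Rightarrow> complex) \<Rightarrow> nat \<Rightarrow> complex" where
  "tensor_apply r n T x i =
     (\<Sum>js\<in>{js. length js = r - 1 \<and> set js \<subseteq> {1..n}}.
        complex_of_real (T (i # js)) * prod_list (map x js))"

definition tensor_eigenvalue :: "nat \<Rightarrow> nat \<Rightarrow> tensor \<Rightarrow> complex \<Rightarrow> bool" where
  "tensor_eigenvalue r n T \<mu> \<longleftrightarrow>
     (\<exists>x. (\<exists>i\<in>{1..n}. x i \<noteq> 0) \<and>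
          (\<forall>i\<in>{1..n}. tensor_apply r n T x i = \<mu> * x i ^ (r - 1)))"

text \<open>
  The maximum is expressed by \<^const>\<open>Greatest\<close> rather than \<^const>\<open>Max\<close>, so that its meaning does
  not depend on the set of eigenvalues being finite.
\<close>

definition tensor_spectral_radius :: "nat \<Rightarrow> nat \<Rightarrow> tensor \<Rightarrow> real" where
  "tensor_spectral_radius r n T =
     (GREATEST m. \<exists>\<mu>. tensor_eigenvalue r n T \<mu> \<and> m = cmod \<mu>)"

section \<open>Tensors of a uniform hypergraph\<close>

definition adjacency_tensor :: "nat \<Rightarrow> nat set set \<Rightarrow> tensor" where
  "adjacency_tensor r E js = (if set js \<in> E then 1 / fact (r - 1) else 0)"

definition degree_tensor :: "nat \<Rightarrow> nat set set \<Rightarrow> tensor" where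
  "degree_tensor r E js =
     (if js = replicate r (hd js) then real (hdegree E (hd js)) else 0)"

definition signless_laplacian_tensor :: "nat \<Rightarrow> nat set set \<Rightarrow> tensor" where
  "signless_laplacian_tensor r E js = degree_tensor r E js + adjacency_tensor r E js"

end

theory Submission
  imports Defs "HOL-Analysis.Analysis" "HOL-Combinatorics.Multiset_Permutations"
begin

text \<open>
  The tensor acts by \<open>(Qx)\<^sub>i = d\<^sub>i x\<^sub>i\<^bsup>r-1\<^esup> + (\<Sum>e \<ni> i. \<Prod>j \<in> e - {i}. x\<^sub>j)\<close>. A maximizer \<open>v\<close> of the associated
  form on the nonnegative part of the unit sphere of the \<open>r\<close>-norm is an eigenvector, positive by
  connectedness, and its eigenvalue dominates all others, so it is the spectral radius \<open>\<rho>\<close>.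
  Applying AM-GM to entries divided by those of \<open>v\<close> bounds the multilinear form by
  \<open>\<Sum>i. y\<^sub>i (Qx)\<^sub>i \<le> \<rho> \<parallel>y\<parallel>\<^sub>r \<parallel>x\<parallel>\<^sub>r\<^bsup>r-1\<^esup>\<close>. The bound is the case of constant \<open>x\<close> and
  \<open>y\<^sub>i = d\<^sub>i\<^bsup>1/(r-1)\<^esup>\<close>; equality in the diagonal terms forces \<open>y\<close>, hence the degrees, to be constant.
\<close>

section \<open>Edge form of the signless Laplacian, and connectedness\<close>

definition signless_laplacian_map ::
    "nat \<Rightarrow> 'a set set \<Rightarrow> ('a \<Rightarrow> 'b) \<Rightarrow> 'a \<Rightarrow> 'b::comm_semiring_1" where
  "signless_laplacian_map r E x i =
     of_nat (hdegree E i) * x i ^ (r - 1) + (\<Sum>e\<in>{e \<in> E. i \<in> e}. \<Prod>j\<in>e - {i}. x j)"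

text \<open>For an \<open>r\<close>-uniform hypergraph this is \<Sum>i. x_i (Qx)_i: the factor
  \<open>r\<close> appears because every edge is met once from each of its vertices. Its gradient is
  \<open>r\<close> times \<open>signless_laplacian_map\<close>, so critical points on the sphere of
  the \<open>r\<close>-norm are eigenvectors.\<close>

definition signless_laplacian_form :: "nat \<Rightarrow> 'a set \<Rightarrow> 'a set set \<Rightarrow> ('a \<Rightarrow> real) \<Rightarrow> real" where
  "signless_laplacian_form r V E x =
     (\<Sum>i\<in>V. real (hdegree E i) * x i ^ r) + real r * (\<Sum>e\<in>E. \<Prod>j\<in>e. x j)"

text \<open>If every edge meeting \<open>A\<close> lay inside \<open>A\<close>, then by induction
  along a walk from \<open>a\<close> no vertex could leave \<open>A\<close>, so \<open>b\<close>
  would be unreachable.\<close>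

lemma connected_hypergraph_crossing_edge:
  assumes "connected_hypergraph V E" "a \<in> V" "b \<in> V" "a \<in> A" "b \<notin> A"
  obtains e where "e \<in> E" "e \<inter> A \<noteq> {}" "\<not> e \<subseteq> A"
proof (rule ccontr)
  assume "\<not> thesis"
  with that have closed: "e \<subseteq> A" if "e \<in> E" "e \<inter> A \<noteq> {}" for e
    using \<open>e \<in> E\<close> \<open>e \<inter> A \<noteq> {}\<close> by blast
  obtain vs es where w: "walk V E vs es" and ends: "hd vs = a" "last vs = b"
    using assms unfolding connected_hypergraph_def by blast
  have len: "length vs = length es + 1" and sub: "set es \<subseteq> E"
    and step: "\<And>k. k < length es \<Longrightarrow> {vs ! k, vs ! (k + 1)} \<subseteq> es ! k"
    using w unfolding walk_def by auto
  have nonempty: "vs \<noteq> []"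
    using len by auto
  have "vs ! k \<in> A" if "k \<le> length es" for k
    using that
  proof (induction k)
    case 0
    then show ?case
      using assms(4) ends(1) hd_conv_nth[OF nonempty] by simp
  next
    case (Suc k)
    then have "es ! k \<in> E" "vs ! k \<in> A" "{vs ! k, vs ! Suc k} \<subseteq> es ! k"
      using sub step[of k] by auto
    then have "es ! k \<subseteq> A"
      by (intro closed) auto
    with \<open>{vs ! k, vs ! Suc k} \<subseteq> es ! k\<close> show ?case
      by auto
  qed
  from this[of "length es"] have "last vs \<in> A"
    using last_conv_nth[OF nonempty] len by simp
  with ends(2) assms(5) show False by simp
qed

section \<open>Compactness in the function space\<close>

lemma continuous_on_apply_argument [continuous_intros]:
  "continuous_on S (\<lambda>x::'a \<Rightarrow> 'b::topological_space. x i)"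
  by (rule continuous_on_subset[OF continuous_on_product_coordinates]) simp

text \<open>Pinning the coordinates outside \<open>V\<close> to 0 turns the set into a product of
  compact factors over the whole index type, so Tychonoff's theorem applies.\<close>

lemma compact_supported_cube:
  "compact {x::'a \<Rightarrow> real. (\<forall>i\<in>V. 0 \<le> x i \<and> x i \<le> 1) \<and> (\<forall>i. i \<notin> V \<longrightarrow> x i = 0)}"
proof -
  have eq: "{x::'a \<Rightarrow> real. (\<forall>i\<in>V. 0 \<le> x i \<and> x i \<le> 1) \<and> (\<forall>i. i \<notin> V \<longrightarrow> x i = 0)} =
      PiE UNIV (\<lambda>i. if i \<in> V then {0..1} else {0})"
    by (auto simp: PiE_def Pi_def split: if_splits)
  have "compactin (product_topology (\<lambda>i. euclidean) UNIV)
      (PiE UNIV (\<lambda>i::'a. if i \<in> V then {0..1::real} else {0}))"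
    by (subst compactin_PiE) auto
  then show ?thesis
    unfolding eq by (simp add: euclidean_product_topology)
qed

section \<open>Elementary inequalities: tangent line, Young, AM-GM\<close>

lemma power_ge_affine:
  fixes u :: real
  assumes "0 \<le> u"
  shows "1 + real r * (u - 1) \<le> u ^ r"
  using Bernoulli_inequality[of "u - 1" r] assms by simp

text \<open>Splitting off one factor \<open>u\<close> from the tangent line at 1 leaves the deficit
  \<open>real m * (u - 1)\<^sup>2\<close>, which is positive away from 1; the remaining factor is
  handled by the weak inequality.\<close>

lemma power_gt_affine:
  fixes u :: real
  assumes "0 \<le> u" "u \<noteq> 1" "2 \<le> r"
  shows "1 + real r * (u - 1) < u ^ r"
proof -
  obtain m where m: "r = Suc m" "0 < m"
    using assms(3) by (cases r) auto
  have "1 + real r * (u - 1) = u * (1 + real m * (u - 1)) - real m * (u - 1)\<^sup>2"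
    by (simp add: m(1) power2_eq_square algebra_simps)
  also have "\<dots> < u * (1 + real m * (u - 1))"
    using assms(2) m(2) by simp
  also have "\<dots> \<le> u * u ^ m"
    by (rule mult_left_mono[OF power_ge_affine]) (use assms(1) in auto)
  finally show ?thesis
    by (simp add: m(1))
qed

text \<open>Young's inequality for the exponents r and r/(r-1). Divided by \<open>s ^ r\<close> it
  is the tangent line inequality at \<open>u = y / s\<close>, whose strict form gives the equality
  case.\<close>

lemma young_power:
  fixes y s :: real
  assumes "0 \<le> y" "0 < s" "2 \<le> r"
  shows "real r * (y * s ^ (r - 1)) \<le> y ^ r + real (r - 1) * s ^ r"
    and "real r * (y * s ^ (r - 1)) = y ^ r + real (r - 1) * s ^ r \<Longrightarrow> y = s"
proof -
  have s: "s ^ r = s * s ^ (r - 1)"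
    using assms(3) by (metis power_eq_if not_numeral_le_zero)
  have diff: "y ^ r + real (r - 1) * s ^ r - real r * (y * s ^ (r - 1)) =
      s ^ r * ((y / s) ^ r - (1 + real r * (y / s - 1)))"
    using assms(2,3) by (simp add: power_divide s field_simps of_nat_diff)
  show "real r * (y * s ^ (r - 1)) \<le> y ^ r + real (r - 1) * s ^ r"
    using diff power_ge_affine[of "y / s" r] assms
    by (smt (verit) divide_nonneg_pos mult_nonneg_nonneg zero_le_power)
  assume "real r * (y * s ^ (r - 1)) = y ^ r + real (r - 1) * s ^ r"
  with diff assms(2) have "(y / s) ^ r = 1 + real r * (y / s - 1)"
    by simp
  with power_gt_affine[of "y / s" r] assms have "y / s = 1"
    by (metis divide_nonneg_pos less_irrefl)
  with assms(2) show "y = s" by simp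
qed

text \<open>AM-GM for the numbers \<open>x i ^ card S\<close>, whose geometric mean is the plain
  product.\<close>

lemma prod_le_mean_power:
  fixes x :: "'a \<Rightarrow> real"
  assumes "finite S" "S \<noteq> {}" "\<And>i. i \<in> S \<Longrightarrow> 0 \<le> x i"
  shows "real (card S) * (\<Prod>i\<in>S. x i) \<le> (\<Sum>i\<in>S. x i ^ card S)"
proof -
  have c: "0 < card S"
    using assms(1,2) by (simp add: card_gt_0_iff)
  have P: "0 \<le> (\<Prod>i\<in>S. x i)"
    by (rule prod_nonneg) (use assms(3) in auto)
  have "(\<Prod>i\<in>S. x i ^ card S) powr (1 / card S) \<le> (\<Sum>i\<in>S. x i ^ card S / card S)"
    by (rule arith_geom_mean) (use assms in auto)
  also have "(\<Prod>i\<in>S. x i ^ card S) powr (1 / card S) = (\<Prod>i\<in>S. x i)"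
    using P c by (cases "(\<Prod>i\<in>S. x i) = 0")
      (auto simp: prod_power_distrib[symmetric] powr_realpow[symmetric] powr_powr)
  finally show ?thesis
    using c by (simp add: sum_divide_distrib[symmetric] field_simps)
qed

section \<open>From the tensor to sums over edges\<close>

lemma sum_incident_swap:
  assumes "finite V" "finite E" "\<And>e. e \<in> E \<Longrightarrow> e \<subseteq> V"
  shows "(\<Sum>i\<in>V. \<Sum>e\<in>{e \<in> E. i \<in> e}. f i e) = (\<Sum>e\<in>E. \<Sum>i\<in>e. f i e)"
proof -
  have "(\<Sum>i\<in>V. \<Sum>e\<in>{e \<in> E. i \<in> e}. f i e) = (\<Sum>e\<in>E. \<Sum>i\<in>{i \<in> V. i \<in> e}. f i e)"
    by (rule sum.swap_restrict) (use assms in auto)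
  also have "\<dots> = (\<Sum>e\<in>E. \<Sum>i\<in>e. f i e)"
    by (rule sum.cong[OF refl], rule sum.cong) (use assms(3) in auto)
  finally show ?thesis .
qed

text \<open>The degree part survives only at the constant index list. In the adjacency part the
  index lists belonging to an edge \<open>e\<close> containing \<open>i\<close> are the (r-1)!
  orderings of \<open>e - {i}\<close>, which cancel the entry 1/(r-1)!.\<close>

lemma tensor_apply_signless_laplacian:
  assumes "hypergraph {1..n} E" "uniform_hypergraph r E" "i \<in> {1..n}" "0 < r"
  shows "tensor_apply r n (signless_laplacian_tensor r E) x i = signless_laplacian_map r E x i"
proof -
  let ?L = "{js. length js = r - 1 \<and> set js \<subseteq> {1..n}}"
  have edge: "e \<subseteq> {1..n}" "card e = r" "finite e" if "e \<in> E" for e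
    using assms(1,2) that finite_subset
    unfolding hypergraph_def uniform_hypergraph_def by fastforce+
  have finE: "finite E"
    using edge(1) finite_subset[of E "Pow {1..n}"] by auto
  have finL: "finite ?L"
    using finite_lists_length_eq[of "{1..n}" "r - 1"] by (subst conj_commute) simp
  obtain m where m: "r = Suc m"
    using assms(4) by (cases r) auto
  have finL': "finite {js \<in> ?L. insert i (set js) \<in> E}"
    by (rule finite_subset[OF _ finL]) auto
  have diag: "(\<Sum>js\<in>?L. complex_of_real (degree_tensor r E (i # js)) * prod_list (map x js)) =
      of_nat (hdegree E i) * x i ^ (r - 1)"
  proof -
    have "(\<Sum>js\<in>?L. complex_of_real (degree_tensor r E (i # js)) * prod_list (map x js)) =
      (\<Sum>js\<in>?L. if js = replicate (r - 1) i then of_nat (hdegree E i) * x i ^ (r - 1) else 0)"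
      by (rule sum.cong) (auto simp: degree_tensor_def m)
    also have "\<dots> = of_nat (hdegree E i) * x i ^ (r - 1)"
      using finL assms(3) by (subst sum.delta) auto
    finally show ?thesis .
  qed
  \<comment> \<open>Together with \<open>i\<close>, only r-1 list entries must cover the r vertices
    of \<open>e\<close>, so there is no room for a repetition or for \<open>i\<close>
    itself.\<close>
  have fibre: "{js \<in> ?L. insert i (set js) = e} = permutations_of_set (e - {i})"
    if "e \<in> E" "i \<in> e" for e
  proof (intro equalityI subsetI)
    fix js assume "js \<in> {js \<in> ?L. insert i (set js) = e}"
    then have js: "length js = r - 1" "insert i (set js) = e" by auto
    have "card e = r" using edge that by simp
    have "i \<notin> set js"
    proof
      assume "i \<in> set js"
      then have "card e \<le> length js"
        using js(2) card_length[of js] by (simp add: insert_absorb)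
      with js(1) \<open>card e = r\<close> assms(4) show False by simp
    qed
    moreover from this have "distinct js"
      using js \<open>card e = r\<close> by (auto intro!: card_distinct)
    ultimately show "js \<in> permutations_of_set (e - {i})"
      using js(2) by (auto simp: permutations_of_set_def)
  next
    fix js assume "js \<in> permutations_of_set (e - {i})"
    then have js: "set js = e - {i}" "distinct js"
      by (auto simp: permutations_of_set_def)
    then have "length js = r - 1"
      using edge that by (metis distinct_card card_Diff_singleton)
    then show "js \<in> {js \<in> ?L. insert i (set js) = e}"
      using js(1) edge(1)[OF that(1)] that(2) by auto
  qed
  have "(\<Sum>js\<in>?L. complex_of_real (adjacency_tensor r E (i # js)) * prod_list (map x js)) =
      (\<Sum>js\<in>{js \<in> ?L. insert i (set js) \<in> E}. prod_list (map x js) / fact (r - 1))"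
    using finL by (intro sum.mono_neutral_cong_right) (auto simp: adjacency_tensor_def)
  also have "\<dots> = (\<Sum>e\<in>{e \<in> E. i \<in> e}. \<Sum>js\<in>{js \<in> {js \<in> ?L. insert i (set js) \<in> E}. insert i (set js) = e}.
      prod_list (map x js) / fact (r - 1))"
    by (rule sum.group[symmetric]) (use finE finL' in auto)
  also have "\<dots> = (\<Sum>e\<in>{e \<in> E. i \<in> e}. \<Prod>j\<in>e - {i}. x j)"
  proof (rule sum.cong[OF refl])
    fix e assume "e \<in> {e \<in> E. i \<in> e}"
    then have e: "e \<in> E" "i \<in> e" by auto
    have "(\<Sum>js\<in>{js \<in> {js \<in> ?L. insert i (set js) \<in> E}. insert i (set js) = e}.
        prod_list (map x js) / fact (r - 1)) =
        (\<Sum>js\<in>permutations_of_set (e - {i}). prod_list (map x js) / fact (r - 1))"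
    proof (rule sum.cong[OF _ refl])
      show "{js \<in> {js \<in> ?L. insert i (set js) \<in> E}. insert i (set js) = e} =
          permutations_of_set (e - {i})"
        unfolding fibre[OF e, symmetric] using e(1) by blast
    qed
    also have "\<dots> = (\<Sum>js\<in>permutations_of_set (e - {i}). (\<Prod>j\<in>e - {i}. x j) / fact (r - 1))"
      by (rule sum.cong[OF refl]) (metis permutations_of_setD prod.distinct_set_conv_list)
    also have "\<dots> = (\<Prod>j\<in>e - {i}. x j)"
      using edge(2,3)[OF e(1)] e(2) by (simp add: card_Diff_singleton)
    finally show "(\<Sum>js\<in>{js \<in> {js \<in> ?L. insert i (set js) \<in> E}. insert i (set js) = e}.
        prod_list (map x js) / fact (r - 1)) = (\<Prod>j\<in>e - {i}. x j)" .
  qed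
  finally show ?thesis
    using diag unfolding tensor_apply_def signless_laplacian_map_def
    by (simp add: signless_laplacian_tensor_def ring_distribs sum.distrib)
qed

section \<open>Connected uniform hypergraphs\<close>

locale connected_uniform_hypergraph =
  fixes V :: "'a set" and E :: "'a set set" and r :: nat
  assumes hypergraph: "hypergraph V E"
    and uniform: "uniform_hypergraph r E"
    and connected: "connected_hypergraph V E"
    and rank: "2 \<le> r"
    and nonempty: "V \<noteq> {}"
begin

lemma finite_V: "finite V"
  using hypergraph unfolding hypergraph_def by simp

lemma edge_subset: "e \<in> E \<Longrightarrow> e \<subseteq> V"
  using hypergraph unfolding hypergraph_def by simp

lemma edge_nonempty: "e \<in> E \<Longrightarrow> e \<noteq> {}"
  using hypergraph unfolding hypergraph_def by simp

lemma card_edge: "e \<in> E \<Longrightarrow> card e = r"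
  using uniform unfolding uniform_hypergraph_def by simp

lemma finite_edge: "e \<in> E \<Longrightarrow> finite e"
  using edge_subset finite_V finite_subset by blast

lemma finite_E: "finite E"
  using edge_subset finite_V finite_subset[of E "Pow V"] by auto

lemma power_rank: "(x::'b::monoid_mult) ^ r = x * x ^ (r - 1)"
  using rank by (metis power_eq_if not_numeral_le_zero)

subsection \<open>The positive eigenvector\<close>

text \<open>Isolates the dependence on one coordinate: an edge product is linear in each of its
  vertices, so only a term in \<open>t ^ r\<close> and one in \<open>t\<close> remain beside a
  constant.\<close>

lemma form_fun_upd:
  assumes "i \<in> V"
  shows "signless_laplacian_form r V E (x(i := t)) =
    ((\<Sum>j\<in>V - {i}. real (hdegree E j) * x j ^ r) + real r * (\<Sum>e\<in>{e \<in> E. i \<notin> e}. \<Prod>j\<in>e. x j))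
    + real (hdegree E i) * t ^ r + real r * t * (\<Sum>e\<in>{e \<in> E. i \<in> e}. \<Prod>j\<in>e - {i}. x j)"
proof -
  have deg: "(\<Sum>j\<in>V. real (hdegree E j) * (x(i := t)) j ^ r) =
      real (hdegree E i) * t ^ r + (\<Sum>j\<in>V - {i}. real (hdegree E j) * x j ^ r)"
    by (subst sum.remove[OF finite_V assms]) (auto intro!: sum.cong)
  have off: "(\<Prod>j\<in>e. (x(i := t)) j) = (\<Prod>j\<in>e. x j)" if "i \<notin> e" for e
    using that by (intro prod.cong) auto
  have on: "(\<Prod>j\<in>e. (x(i := t)) j) = t * (\<Prod>j\<in>e - {i}. x j)" if "e \<in> E" "i \<in> e" for e
    by (subst prod.remove[OF finite_edge[OF that(1)] that(2)]) (auto intro!: prod.cong)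
  have "(\<Sum>e\<in>E. \<Prod>j\<in>e. (x(i := t)) j) =
      (\<Sum>e\<in>{e \<in> E. i \<in> e}. \<Prod>j\<in>e. (x(i := t)) j) + (\<Sum>e\<in>{e \<in> E. i \<notin> e}. \<Prod>j\<in>e. (x(i := t)) j)"
    using finite_E by (subst sum.union_disjoint[symmetric]) (auto intro!: sum.cong)
  also have "\<dots> = t * (\<Sum>e\<in>{e \<in> E. i \<in> e}. \<Prod>j\<in>e - {i}. x j) + (\<Sum>e\<in>{e \<in> E. i \<notin> e}. \<Prod>j\<in>e. x j)"
    unfolding sum_distrib_left by (intro arg_cong2[where f = "(+)"] sum.cong on off) auto
  finally show ?thesis
    unfolding signless_laplacian_form_def deg by (simp add: algebra_simps)
qed

text \<open>A maximum exists on the compact set of nonnegative unit vectors; since the form is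
  homogeneous of degree \<open>r\<close>, rescaling turns maximality there into an inequality for
  all nonnegative vectors.\<close>

lemma exists_form_maximizer:
  obtains v M where "\<And>i. i \<in> V \<Longrightarrow> 0 \<le> v i" "(\<Sum>i\<in>V. v i ^ r) = 1"
    "signless_laplacian_form r V E v = M"
    "\<And>x. (\<And>i. i \<in> V \<Longrightarrow> 0 \<le> x i) \<Longrightarrow> signless_laplacian_form r V E x \<le> M * (\<Sum>i\<in>V. x i ^ r)"
proof -
  define C where "C = {x::'a \<Rightarrow> real. (\<forall>i\<in>V. 0 \<le> x i \<and> x i \<le> 1) \<and> (\<forall>i. i \<notin> V \<longrightarrow> x i = 0)}"
  define K where "K = C \<inter> {x. (\<Sum>i\<in>V. x i ^ r) = 1}"
  have r0: "0 < r" using rank by simp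
  have "closed {x::'a \<Rightarrow> real. (\<Sum>i\<in>V. x i ^ r) = 1}"
    by (intro closed_Collect_eq continuous_intros)
  then have "compact K"
    unfolding K_def C_def by (intro compact_Int_closed compact_supported_cube)
  moreover have "K \<noteq> {}"
  proof -
    obtain a where "a \<in> V" using nonempty by blast
    then have "(\<lambda>i. if i = a then 1 else 0) \<in> K"
      using r0 finite_V by (auto simp: K_def C_def power_0_left if_distrib[of "\<lambda>x. x ^ r"] cong: if_cong)
    then show ?thesis by blast
  qed
  moreover have "continuous_on K (signless_laplacian_form r V E)"
    unfolding signless_laplacian_form_def by (intro continuous_intros)
  ultimately obtain v where v: "v \<in> K"
    and max: "\<And>x. x \<in> K \<Longrightarrow> signless_laplacian_form r V E x \<le> signless_laplacian_form r V E v"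
    using continuous_attains_sup by metis
  let ?M = "signless_laplacian_form r V E v"
  have "signless_laplacian_form r V E x \<le> ?M * (\<Sum>i\<in>V. x i ^ r)"
    if x: "\<And>i. i \<in> V \<Longrightarrow> 0 \<le> x i" for x
  proof -
    define S where "S = (\<Sum>i\<in>V. x i ^ r)"
    define c where "c = root r S"
    \<comment> \<open>The normalization of \<open>x\<close>; it is cut off outside \<open>V\<close>
      because members of \<open>C\<close> vanish there.\<close>
    define z where "z = (\<lambda>i. if i \<in> V then x i / c else 0)"
    have "0 \<le> S"
      unfolding S_def by (intro sum_nonneg) (use x in auto)
    show ?thesis
    proof (cases "S = 0")
      \<comment> \<open>A vector of norm 0 cannot be rescaled. It vanishes on \<open>V\<close>, and
        so does every edge product, as edges are nonempty.\<close>
      case True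
      then have x0: "x i = 0" if "i \<in> V" for i
        using that x r0 finite_V by (simp add: S_def sum_nonneg_eq_0_iff)
      have "(\<Prod>j\<in>e. x j) = 0" if "e \<in> E" for e
      proof -
        obtain j where "j \<in> e"
          using edge_nonempty[OF \<open>e \<in> E\<close>] by blast
        moreover from this have "x j = 0"
          using edge_subset[OF \<open>e \<in> E\<close>] x0 by blast
        ultimately show ?thesis
          using finite_edge[OF \<open>e \<in> E\<close>] by (intro prod_zero) auto
      qed
      then show ?thesis
        using x0 True r0 by (simp add: signless_laplacian_form_def S_def power_0_left)
    next
      case False
      with \<open>0 \<le> S\<close> have "0 < S" by simp
      have c: "0 < c" "c ^ r = S"
        using \<open>0 < S\<close> r0 by (simp_all add: c_def)
      have zsum: "(\<Sum>i\<in>V. z i ^ r) = 1"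
        using \<open>0 < S\<close> c(2) by (simp add: z_def power_divide sum_divide_distrib[symmetric] S_def)
      have z0: "0 \<le> z i" for i
        using x c(1) by (simp add: z_def)
      have z1: "z i \<le> 1" if "i \<in> V" for i
      proof -
        have "z i ^ r \<le> 1"
          unfolding zsum[symmetric] by (rule member_le_sum) (use that z0 finite_V in auto)
        with z0 r0 show ?thesis by (metis power_le_one_iff not_gr_zero)
      qed
      have "z \<in> K"
        unfolding K_def C_def using zsum z0 z1 by (simp, simp add: z_def)
      have "signless_laplacian_form r V E z = signless_laplacian_form r V E x / S"
      proof -
        have "(\<Prod>j\<in>e. z j) = (\<Prod>j\<in>e. x j) / S" if "e \<in> E" for e
        proof -
          have "(\<Prod>j\<in>e. z j) = (\<Prod>j\<in>e. x j / c)"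
            using edge_subset[OF that] by (intro prod.cong) (auto simp: z_def)
          then show ?thesis
            using card_edge[OF that] c(2) by (simp add: prod_dividef)
        qed
        then show ?thesis
          unfolding signless_laplacian_form_def
          by (simp add: z_def power_divide c(2) sum_divide_distrib[symmetric] add_divide_distrib)
      qed
      then show ?thesis
        using max[OF \<open>z \<in> K\<close>] \<open>0 < S\<close> by (simp add: S_def[symmetric] divide_le_eq)
    qed
  qed
  with v show ?thesis
    by (intro that[of v ?M]) (auto simp: K_def C_def)
qed

text \<open>
  Raising all vanishing coordinates of a maximizer to \<open>t\<close> costs order \<open>t ^ r\<close> in the constraint,
  but an edge with only \<open>k < r\<close> vanishing vertices gains order \<open>t ^ k\<close>.
\<close>

lemma form_maximizer_pos:
  assumes nonneg: "\<And>i. i \<in> V \<Longrightarrow> 0 \<le> v i" and norm: "(\<Sum>i\<in>V. v i ^ r) = 1"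
    and max: "signless_laplacian_form r V E v = M"
      "\<And>x. (\<And>i. i \<in> V \<Longrightarrow> 0 \<le> x i) \<Longrightarrow> signless_laplacian_form r V E x \<le> M * (\<Sum>i\<in>V. x i ^ r)"
    and "a \<in> V"
  shows "0 < v a"
proof (rule ccontr)
  assume "\<not> 0 < v a"
  with nonneg \<open>a \<in> V\<close> have "v a = 0" by force
  have r0: "0 < r" using rank by simp
  obtain b where b: "b \<in> V" "v b \<noteq> 0"
    using norm r0 by (metis (no_types, lifting) power_0_left sum.neutral not_gr_zero zero_neq_one)
  define Z where "Z = {i \<in> V. v i = 0}"
  \<comment> \<open>Some edge has both vanishing and non-vanishing vertices. Hence
    \<open>k < r\<close>, and the product \<open>c\<close> over its non-vanishing vertices is
    positive.\<close>
  obtain e where e: "e \<in> E" "e \<inter> Z \<noteq> {}" "\<not> e \<subseteq> Z"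
    using connected_hypergraph_crossing_edge[OF connected \<open>a \<in> V\<close> b(1), of Z]
      \<open>v a = 0\<close> \<open>a \<in> V\<close> b by (auto simp: Z_def)
  define k where "k = card (e \<inter> Z)"
  define c where "c = (\<Prod>j\<in>e - Z. v j)"
  have "k < r"
    unfolding k_def card_edge[OF e(1), symmetric]
    using e by (intro psubset_card_mono finite_edge) auto
  have c: "0 < c"
    unfolding c_def using nonneg edge_subset[OF e(1)]
    by (intro prod_pos) (force simp: Z_def less_le)
  define B where "B = M * real (card Z)"
  have key: "real r * c \<le> B * t" if t: "0 < t" "t \<le> 1" for t
  proof -
    define x where "x = (\<lambda>i. if i \<in> Z then t else v i)"
    have x0: "0 \<le> x i" if "i \<in> V" for i
      using nonneg t that by (simp add: x_def)
    have vx: "v i \<le> x i" "0 \<le> v i" if "i \<in> V" for i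
      using nonneg t that by (auto simp: x_def Z_def)
    have "(\<Sum>i\<in>V. x i ^ r) = (\<Sum>i\<in>V. v i ^ r + (if i \<in> Z then t ^ r else 0))"
      using r0 by (intro sum.cong) (auto simp: x_def Z_def)
    also have "\<dots> = 1 + real (card Z) * t ^ r"
      using finite_V by (simp add: sum.distrib norm sum.If_cases Z_def Int_def)
    finally have xsum: "(\<Sum>i\<in>V. x i ^ r) = 1 + real (card Z) * t ^ r" .
    \<comment> \<open>The edge \<open>e\<close> contributed nothing before, so its new product
      \<open>t ^ k * c\<close> is a pure gain; no other term decreases.\<close>
    have "(\<Prod>j\<in>e. v j) = 0"
      using e finite_edge by (auto simp: Z_def)
    have "(\<Prod>j\<in>e. x j) = (\<Prod>j\<in>e \<inter> Z. x j) * (\<Prod>j\<in>e - Z. x j)"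
      using finite_edge[OF e(1)] by (rule prod.Int_Diff)
    also have "(\<Prod>j\<in>e \<inter> Z. x j) = t ^ k"
      by (simp add: x_def k_def)
    also have "(\<Prod>j\<in>e - Z. x j) = c"
      unfolding c_def by (intro prod.cong) (auto simp: x_def)
    finally have xe: "(\<Prod>j\<in>e. x j) = t ^ k * c" .
    have "(\<Sum>f\<in>E. \<Prod>j\<in>f. v j) + t ^ k * c \<le> (\<Sum>f\<in>E. \<Prod>j\<in>f. x j)"
    proof -
      have "(\<Sum>f\<in>E - {e}. \<Prod>j\<in>f. v j) \<le> (\<Sum>f\<in>E - {e}. \<Prod>j\<in>f. x j)"
        using vx edge_subset by (intro sum_mono prod_mono) blast
      then show ?thesis
        using \<open>(\<Prod>j\<in>e. v j) = 0\<close> xe by (simp add: sum.remove[OF finite_E e(1)])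
    qed
    moreover have "(\<Sum>i\<in>V. real (hdegree E i) * v i ^ r) \<le> (\<Sum>i\<in>V. real (hdegree E i) * x i ^ r)"
      using vx by (intro sum_mono mult_left_mono power_mono) auto
    ultimately have "M + real r * (t ^ k * c) \<le> signless_laplacian_form r V E x"
      unfolding max(1)[symmetric] signless_laplacian_form_def
      using r0 by (smt (verit) distrib_left mult_left_mono of_nat_0_le_iff)
    also have "\<dots> \<le> M * (1 + real (card Z) * t ^ r)"
      using max(2)[of x] x0 xsum by simp
    finally have "real r * c * t ^ k \<le> B * t ^ r"
      by (simp add: B_def algebra_simps)
    also have "\<dots> = B * t ^ (r - k) * t ^ k"
      using \<open>k < r\<close> by (simp add: power_add[symmetric])
    finally have le: "real r * c \<le> B * t ^ (r - k)"
      using t(1) by simp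
    then have "0 < B"
      using c r0 t by (smt (verit) mult_pos_pos of_nat_0_less_iff zero_less_mult_pos2 zero_less_power)
    have "t ^ (r - k) \<le> t ^ 1"
      using t \<open>k < r\<close> by (intro power_decreasing) auto
    with le \<open>0 < B\<close> show ?thesis
      by (smt (verit) mult_left_mono power_one_right)
  qed
  have "0 < B" "0 < real r * c"
    using key[of 1] c r0 by auto (smt (verit) mult_pos_pos of_nat_0_less_iff)+
  \<comment> \<open>At \<open>t = 1\<close> the estimate gives r c \<le> B, so t = r c / (2B) is
    admissible; there it reads r c \<le> r c / 2, although r c is positive.\<close>
  then show False
    using key[of 1] key[of "real r * c / (2 * B)"] by (simp add: divide_le_eq mult.commute)
qed

text \<open>The homogeneous inequality has no side constraint, so one coordinate of the maximizer
  can be varied freely. The difference of its two sides has an interior maximum at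
  \<open>v i\<close>, and its vanishing derivative is \<open>r\<close> times the eigenvalue equation
  at \<open>i\<close>.\<close>

lemma exists_positive_eigenvector:
  obtains v :: "'a \<Rightarrow> real" and M where "\<And>i. i \<in> V \<Longrightarrow> 0 < v i"
    "\<And>i. i \<in> V \<Longrightarrow> signless_laplacian_map r E v i = M * v i ^ (r - 1)"
proof -
  obtain v M where v: "\<And>i. i \<in> V \<Longrightarrow> 0 \<le> v i" "(\<Sum>i\<in>V. v i ^ r) = 1"
    and max: "signless_laplacian_form r V E v = M"
      "\<And>x. (\<And>i. i \<in> V \<Longrightarrow> 0 \<le> x i) \<Longrightarrow> signless_laplacian_form r V E x \<le> M * (\<Sum>i\<in>V. x i ^ r)"
    using exists_form_maximizer by metis
  have pos: "0 < v i" if "i \<in> V" for i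
    using form_maximizer_pos[OF v max that] .
  have "signless_laplacian_map r E v i = M * v i ^ (r - 1)" if i: "i \<in> V" for i
  proof -
    define A where "A = (\<Sum>e\<in>{e \<in> E. i \<in> e}. \<Prod>j\<in>e - {i}. v j)"
    define C where "C = (\<Sum>j\<in>V - {i}. real (hdegree E j) * v j ^ r) +
      real r * (\<Sum>e\<in>{e \<in> E. i \<notin> e}. \<Prod>j\<in>e. v j) - M * (\<Sum>j\<in>V - {i}. v j ^ r)"
    define g where "g = (\<lambda>t. C + real (hdegree E i) * t ^ r + real r * t * A - M * t ^ r)"
    have g: "g t = signless_laplacian_form r V E (v(i := t)) - M * (\<Sum>j\<in>V. (v(i := t)) j ^ r)" for t
    proof -
      have "(\<Sum>j\<in>V. (v(i := t)) j ^ r) = t ^ r + (\<Sum>j\<in>V - {i}. v j ^ r)"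
        by (subst sum.remove[OF finite_V i]) (auto intro!: sum.cong)
      then show ?thesis
        unfolding g_def C_def form_fun_upd[OF i] A_def by (simp add: algebra_simps)
    qed
    have "g (v i) = 0"
      using g[of "v i"] max(1) v(2) by simp
    moreover have "g t \<le> 0" if "0 \<le> t" for t
      using max(2)[of "v(i := t)"] v(1) that by (simp add: g)
    \<comment> \<open>The radius \<open>v i\<close>, positive by the previous lemma, keeps
      \<open>t\<close> in the range where maximality is known.\<close>
    ultimately have "\<forall>t. \<bar>v i - t\<bar> < v i \<longrightarrow> g t \<le> g (v i)"
      by auto
    moreover have "(g has_real_derivative real r * (real (hdegree E i) * v i ^ (r - 1) + A - M * v i ^ (r - 1))) (at (v i))"
      unfolding g_def by (auto intro!: derivative_eq_intros simp: algebra_simps)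
    ultimately have "real r * (real (hdegree E i) * v i ^ (r - 1) + A - M * v i ^ (r - 1)) = 0"
      using DERIV_local_max pos[OF i] by blast
    then show ?thesis
      using rank by (simp add: signless_laplacian_map_def A_def)
  qed
  with pos show ?thesis
    using that[of v M] by simp
qed

text \<open>At an index \<open>i\<close> maximizing the ratio |x_i| / v_i, the vector |x| lies below
  the multiple \<open>c\<close> of \<open>v\<close> and touches it. The triangle inequality and
  monotonicity then bound |\<mu>| |x_i|^(r-1) by M |x_i|^(r-1).\<close>

lemma eigenvalue_le_positive_eigenvalue:
  fixes v :: "'a \<Rightarrow> real" and x :: "'a \<Rightarrow> complex"
  assumes pos: "\<And>i. i \<in> V \<Longrightarrow> 0 < v i"
    and v: "\<And>i. i \<in> V \<Longrightarrow> signless_laplacian_map r E v i = M * v i ^ (r - 1)"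
    and x: "\<And>i. i \<in> V \<Longrightarrow> signless_laplacian_map r E x i = \<mu> * x i ^ (r - 1)"
    and "a \<in> V" "x a \<noteq> 0"
  shows "cmod \<mu> \<le> M"
proof -
  obtain i where i: "i \<in> V" and max: "\<And>j. j \<in> V \<Longrightarrow> cmod (x j) / v j \<le> cmod (x i) / v i"
  proof -
    have "Max ((\<lambda>j. cmod (x j) / v j) ` V) \<in> (\<lambda>j. cmod (x j) / v j) ` V"
      using finite_V nonempty by (intro Max_in) auto
    then obtain i where "i \<in> V" "Max ((\<lambda>j. cmod (x j) / v j) ` V) = cmod (x i) / v i"
      by blast
    moreover have "cmod (x j) / v j \<le> Max ((\<lambda>j. cmod (x j) / v j) ` V)" if "j \<in> V" for j
      using finite_V that by (intro Max_ge) auto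
    ultimately show ?thesis
      using that[of i] by simp
  qed
  define c where "c = cmod (x i) / v i"
  have "0 < cmod (x a) / v a"
    using assms(4,5) pos by simp
  with max[OF \<open>a \<in> V\<close>] have c: "0 < c"
    by (simp add: c_def)
  have xi: "cmod (x i) = c * v i"
    using pos[OF i] by (simp add: c_def)
  have xj: "cmod (x j) \<le> c * v j" if "j \<in> V" for j
    using max[OF that] pos[OF that] by (simp add: c_def divide_le_eq)
  have "cmod \<mu> * cmod (x i) ^ (r - 1) = cmod (signless_laplacian_map r E x i)"
    using x[OF i] by (simp add: norm_mult norm_power)
  also have "\<dots> \<le> real (hdegree E i) * cmod (x i) ^ (r - 1) +
      (\<Sum>e\<in>{e \<in> E. i \<in> e}. \<Prod>j\<in>e - {i}. cmod (x j))"
    unfolding signless_laplacian_map_def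
    by (rule norm_triangle_le, rule add_mono)
      (auto simp: norm_mult norm_power prod_norm intro!: sum_norm_le)
  also have "\<dots> \<le> real (hdegree E i) * (c * v i) ^ (r - 1) +
      (\<Sum>e\<in>{e \<in> E. i \<in> e}. \<Prod>j\<in>e - {i}. c * v j)"
    unfolding xi using xj edge_subset
    by (intro add_left_mono sum_mono prod_mono) (blast intro: norm_ge_zero)
  \<comment> \<open>Both parts of the map are homogeneous of degree r-1, as \<open>e - {i}\<close>
    has r-1 elements.\<close>
  also have "\<dots> = c ^ (r - 1) * signless_laplacian_map r E v i"
    unfolding signless_laplacian_map_def distrib_left sum_distrib_left
    by (intro arg_cong2[where f = "(+)"] sum.cong)
      (auto simp: power_mult_distrib prod.distrib card_edge card_Diff_singleton)
  also have "\<dots> = M * cmod (x i) ^ (r - 1)"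
    by (simp add: v[OF i] xi power_mult_distrib)
  finally show ?thesis
    using c pos[OF i] xi by simp
qed

lemma positive_eigenvalue_nonneg:
  fixes v :: "'a \<Rightarrow> real"
  assumes pos: "\<And>i. i \<in> V \<Longrightarrow> 0 < v i"
    and v: "\<And>i. i \<in> V \<Longrightarrow> signless_laplacian_map r E v i = M * v i ^ (r - 1)"
  shows "0 \<le> M"
proof -
  obtain i where i: "i \<in> V" using nonempty by blast
  have "0 \<le> signless_laplacian_map r E v i"
    unfolding signless_laplacian_map_def using pos i edge_subset
    by (intro add_nonneg_nonneg sum_nonneg prod_nonneg mult_nonneg_nonneg) (force simp: less_imp_le)+
  with v[OF i] show ?thesis
    using zero_less_power[OF pos[OF i], of "r - 1"] by (simp add: zero_le_mult_iff)
qed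

subsection \<open>The degree bound\<close>

text \<open>A walk from \<open>i\<close> to another vertex must use an edge leaving
  \<open>{i}\<close>. This keeps vanishing degree weights out of the equality case when there are at
  least two vertices.\<close>

lemma degree_pos:
  assumes "i \<in> V" "j \<in> V" "i \<noteq> j"
  shows "0 < hdegree E i"
proof -
  obtain e where "e \<in> E" "e \<inter> {i} \<noteq> {}"
    by (rule connected_hypergraph_crossing_edge[OF connected assms(1,2), of "{i}"]) (use assms(3) in auto)
  then have "{e \<in> E. i \<in> e} \<noteq> {}"
    by auto
  then show ?thesis
    using finite_E by (simp add: hdegree_def card_gt_0_iff)
qed

text \<open>For each \<open>i\<close> in \<open>e\<close>, AM-GM is applied to y_i / v_i and the r-1
  numbers s / v_j with j \<noteq> i. The right side is arranged so that, once summed over edges, the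
  eigenvalue equation for \<open>v\<close> can be inserted.\<close>

lemma edge_sum_le:
  fixes v y :: "'a \<Rightarrow> real" and s :: real
  assumes e: "e \<in> E" and pos: "\<And>i. i \<in> V \<Longrightarrow> 0 < v i" and y: "\<And>i. i \<in> V \<Longrightarrow> 0 \<le> y i" and s: "0 < s"
  shows "(\<Sum>i\<in>e. real r * (y i * s ^ (r - 1))) \<le>
    (\<Sum>i\<in>e. (\<Prod>j\<in>e - {i}. v j) * ((y i ^ r + real (r - 1) * s ^ r) / v i ^ (r - 1)))"
proof -
  define P where "P = (\<Prod>j\<in>e. v j)"
  have fin: "finite e" and card: "card e = r" and inV: "\<And>i. i \<in> e \<Longrightarrow> i \<in> V"
    using e finite_edge card_edge edge_subset by auto
  have P: "0 < P"
    unfolding P_def using pos inV by (intro prod_pos) auto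
  define T where "T = (\<Sum>j\<in>e. (s / v j) ^ r)"
  have single: "real r * (y i * s ^ (r - 1)) \<le> P * ((y i / v i) ^ r + (T - (s / v i) ^ r))"
    if i: "i \<in> e" for i
  proof -
    define x where "x = (\<lambda>j. (if j = i then y i else s) / v j)"
    have "real (card e) * (\<Prod>j\<in>e. x j) \<le> (\<Sum>j\<in>e. x j ^ card e)"
      using fin i inV y pos s by (intro prod_le_mean_power) (auto simp: x_def less_imp_le)
    moreover have "(\<Prod>j\<in>e. x j) = y i * s ^ (r - 1) / P"
    proof -
      have "(\<Prod>j\<in>e. if j = i then y i else s) = y i * (\<Prod>j\<in>e - {i}. s)"
        by (subst prod.remove[OF fin i]) (auto intro!: prod.cong)
      then show ?thesis
        unfolding x_def prod_dividef P_def using card i by (simp add: card_Diff_singleton)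
    qed
    moreover have "(\<Sum>j\<in>e. x j ^ r) = (y i / v i) ^ r + (T - (s / v i) ^ r)"
      unfolding T_def sum.remove[OF fin i, of "\<lambda>j. x j ^ r"] sum.remove[OF fin i, of "\<lambda>j. (s / v j) ^ r"]
      by (auto simp: x_def intro!: sum.cong)
    ultimately show ?thesis
      using P card by (simp add: field_simps)
  qed
  have "(\<Sum>i\<in>e. real r * (y i * s ^ (r - 1))) \<le> (\<Sum>i\<in>e. P * ((y i / v i) ^ r + (T - (s / v i) ^ r)))"
    by (rule sum_mono) (rule single)
  \<comment> \<open>Each (s / v_j)^r occurs for all choices of \<open>i\<close> except i = j, hence
    r-1 times.\<close>
  also have "\<dots> = P * ((\<Sum>i\<in>e. (y i / v i) ^ r) + (real r - 1) * T)"
    using card by (simp add: sum_distrib_left[symmetric] sum.distrib sum_subtractf T_def[symmetric] algebra_simps)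
  also have "\<dots> = (\<Sum>i\<in>e. P * ((y i / v i) ^ r + real (r - 1) * (s / v i) ^ r))"
    using rank by (simp add: T_def sum_distrib_left sum.distrib distrib_left of_nat_diff)
  also have "\<dots> = (\<Sum>i\<in>e. (\<Prod>j\<in>e - {i}. v j) * ((y i ^ r + real (r - 1) * s ^ r) / v i ^ (r - 1)))"
  proof (rule sum.cong[OF refl])
    fix i assume i: "i \<in> e"
    have "P = v i * (\<Prod>j\<in>e - {i}. v j)"
      unfolding P_def by (rule prod.remove[OF fin i])
    then show "P * ((y i / v i) ^ r + real (r - 1) * (s / v i) ^ r) =
        (\<Prod>j\<in>e - {i}. v j) * ((y i ^ r + real (r - 1) * s ^ r) / v i ^ (r - 1))"
      using pos[OF inV[OF i]] by (simp add: power_divide power_rank[of "v i"] field_simps)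
  qed
  finally show ?thesis .
qed

text \<open>The edge part is bounded by AM-GM, while the diagonal part keeps its Young deficits
  explicitly on the left, so that equality can later be read off from them.\<close>

lemma weighted_degree_sum_le:
  fixes v y :: "'a \<Rightarrow> real" and s :: real
  assumes pos: "\<And>i. i \<in> V \<Longrightarrow> 0 < v i"
    and v: "\<And>i. i \<in> V \<Longrightarrow> signless_laplacian_map r E v i = M * v i ^ (r - 1)"
    and y: "\<And>i. i \<in> V \<Longrightarrow> 0 \<le> y i" and s: "0 < s"
  shows "(\<Sum>i\<in>V. real (hdegree E i) * (y i ^ r + real (r - 1) * s ^ r - real r * (y i * s ^ (r - 1))))
    \<le> M * ((\<Sum>i\<in>V. y i ^ r) + real (r - 1) * real (card V) * s ^ r)
      - 2 * real r * s ^ (r - 1) * (\<Sum>i\<in>V. real (hdegree E i) * y i)"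
proof -
  define w where "w = (\<lambda>i. y i ^ r + real (r - 1) * s ^ r)"
  define A where "A = (\<lambda>i. \<Sum>e\<in>{e \<in> E. i \<in> e}. \<Prod>j\<in>e - {i}. v j)"
  have "real r * s ^ (r - 1) * (\<Sum>i\<in>V. real (hdegree E i) * y i) =
      (\<Sum>i\<in>V. \<Sum>e\<in>{e \<in> E. i \<in> e}. real r * (y i * s ^ (r - 1)))"
    by (simp add: hdegree_def sum_distrib_left algebra_simps)
  also have "\<dots> = (\<Sum>e\<in>E. \<Sum>i\<in>e. real r * (y i * s ^ (r - 1)))"
    by (rule sum_incident_swap[OF finite_V finite_E edge_subset])
  also have "\<dots> \<le> (\<Sum>e\<in>E. \<Sum>i\<in>e. (\<Prod>j\<in>e - {i}. v j) * (w i / v i ^ (r - 1)))"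
    unfolding w_def by (intro sum_mono edge_sum_le pos y s)
  also have "\<dots> = (\<Sum>i\<in>V. \<Sum>e\<in>{e \<in> E. i \<in> e}. (\<Prod>j\<in>e - {i}. v j) * (w i / v i ^ (r - 1)))"
    by (rule sum_incident_swap[OF finite_V finite_E edge_subset, symmetric])
  \<comment> \<open>By the eigenvalue equation the edge part at \<open>i\<close>, divided by
    \<open>v i ^ (r - 1)\<close>, is M - d_i.\<close>
  also have "\<dots> = (\<Sum>i\<in>V. (M - real (hdegree E i)) * w i)"
  proof (rule sum.cong[OF refl])
    fix i assume i: "i \<in> V"
    have "A i = (M - real (hdegree E i)) * v i ^ (r - 1)"
      using v[OF i] by (simp add: signless_laplacian_map_def A_def algebra_simps)
    then have "A i * (w i / v i ^ (r - 1)) = (M - real (hdegree E i)) * w i"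
      using pos[OF i] by simp
    then show "(\<Sum>e\<in>{e \<in> E. i \<in> e}. (\<Prod>j\<in>e - {i}. v j) * (w i / v i ^ (r - 1))) =
        (M - real (hdegree E i)) * w i"
      by (simp only: A_def sum_distrib_right)
  qed
  also have "\<dots> = M * (\<Sum>i\<in>V. w i) - (\<Sum>i\<in>V. real (hdegree E i) * w i)"
    by (simp add: left_diff_distrib sum_subtractf sum_distrib_left)
  also have "(\<Sum>i\<in>V. w i) = (\<Sum>i\<in>V. y i ^ r) + real (r - 1) * real (card V) * s ^ r"
    by (simp add: w_def sum.distrib)
  finally have main: "real r * s ^ (r - 1) * (\<Sum>i\<in>V. real (hdegree E i) * y i) \<le>
      M * ((\<Sum>i\<in>V. y i ^ r) + real (r - 1) * real (card V) * s ^ r) - (\<Sum>i\<in>V. real (hdegree E i) * w i)" .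
  \<comment> \<open>The diagonal part supplies a second copy of r s^(r-1) \<Sum>i. d_i y_i; this is
    the source of the factor 2.\<close>
  have "(\<Sum>i\<in>V. real (hdegree E i) * (w i - real r * (y i * s ^ (r - 1)))) =
      (\<Sum>i\<in>V. real (hdegree E i) * w i) - real r * s ^ (r - 1) * (\<Sum>i\<in>V. real (hdegree E i) * y i)"
    by (simp add: right_diff_distrib sum_subtractf sum_distrib_left algebra_simps)
  with main show ?thesis
    unfolding w_def by simp
qed

text \<open>With y_i = d_i^(1/(r-1)) and n s^r = \<Sum>i. y_i^r = S, the preceding bound becomes r S
  (M - b), where b = 2 s^(r-1). Nonnegative deficits give b \<le> M; if M = b, all weighted deficits
  vanish, which forces y_i = s wherever d_i is positive.\<close>

lemma degree_power_mean_le: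
  fixes v :: "'a \<Rightarrow> real"
  assumes pos: "\<And>i. i \<in> V \<Longrightarrow> 0 < v i"
    and v: "\<And>i. i \<in> V \<Longrightarrow> signless_laplacian_map r E v i = M * v i ^ (r - 1)"
  defines "b \<equiv> 2 * (1 / real (card V) * (\<Sum>i\<in>V. real (hdegree E i) powr (real r / (real r - 1))))
      powr ((real r - 1) / real r)"
  shows "b \<le> M" and "M = b \<Longrightarrow> regular_hypergraph V E"
proof -
  define S where "S = (\<Sum>i\<in>V. real (hdegree E i) powr (real r / (real r - 1)))"
  have n: "0 < real (card V)"
    using finite_V nonempty by (simp add: card_gt_0_iff)
  have r: "0 < real r" "0 < real r - 1" "real (r - 1) = real r - 1"
    using rank by auto
  have "0 \<le> S"
    unfolding S_def by (intro sum_nonneg) simp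
  have "b \<le> M \<and> (M = b \<longrightarrow> regular_hypergraph V E)"
  proof (cases "S = 0")
    case True
    then have "hdegree E i = 0" if "i \<in> V" for i
      using that finite_V by (simp add: S_def sum_nonneg_eq_0_iff)
    then have "regular_hypergraph V E"
      by (simp add: regular_hypergraph_def)
    moreover have "b = 0"
      using True by (simp add: b_def S_def[symmetric])
    ultimately show ?thesis
      using positive_eigenvalue_nonneg[OF pos v] by simp
  next
    case False
    with \<open>0 \<le> S\<close> have S: "0 < S" by simp
    define y where "y = (\<lambda>i. real (hdegree E i) powr (1 / (real r - 1)))"
    define s where "s = (1 / real (card V) * S) powr (1 / real r)"
    have s: "0 < s"
      using S n by (simp add: s_def)
    have y0: "0 \<le> y i" for i
      by (simp add: y_def)
    \<comment> \<open>For degree 0 both sides are 0, since \<open>0 powr a = 0\<close> for every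
      \<open>a\<close> and \<open>m\<close> is positive.\<close>
    have ypow: "y i ^ m = real (hdegree E i) powr (real m / (real r - 1))" if "0 < m" for i m
      using that by (cases "hdegree E i = 0") (auto simp: y_def powr_realpow[symmetric] powr_powr)
    have spow: "s ^ m = (1 / real (card V) * S) powr (real m / real r)" for m
      using S n by (simp add: s_def powr_realpow[symmetric] powr_powr)
    have yr: "y i ^ r = real (hdegree E i) powr (real r / (real r - 1))" for i
      using ypow[of r i] rank by simp
    have yr1: "y i ^ (r - 1) = real (hdegree E i)" for i
      using ypow[of "r - 1" i] rank r by simp
    have dy: "real (hdegree E i) * y i = y i ^ r" for i
      unfolding power_rank[of "y i"] yr1 by (rule mult.commute)
    have sr: "real (card V) * s ^ r = S"
      using spow[of r] r n S by simp
    have bs: "b = 2 * s ^ (r - 1)"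
      unfolding spow r(3) b_def S_def ..
    define D where "D = (\<lambda>i. y i ^ r + real (r - 1) * s ^ r - real r * (y i * s ^ (r - 1)))"
    have D: "0 \<le> D i" "D i = 0 \<Longrightarrow> y i = s" for i
      using young_power[OF y0 s rank, of i] by (simp_all add: D_def)
    have Sy: "(\<Sum>i\<in>V. y i ^ r) = S"
      by (simp add: yr S_def)
    have "(\<Sum>i\<in>V. real (hdegree E i) * D i) \<le> M * (S + real (r - 1) * (real (card V) * s ^ r)) -
        2 * real r * s ^ (r - 1) * S"
      using weighted_degree_sum_le[of v M y s, OF pos v y0 s] by (simp add: D_def dy Sy mult.assoc)
    also have "\<dots> = real r * S * (M - b)"
      unfolding sr bs r(3) by (simp add: algebra_simps)
    finally have key: "(\<Sum>i\<in>V. real (hdegree E i) * D i) \<le> real r * S * (M - b)" .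
    have "0 \<le> (\<Sum>i\<in>V. real (hdegree E i) * D i)"
      using D(1) by (intro sum_nonneg) simp
    with key have "0 \<le> real r * S * (M - b)" by linarith
    then have "b \<le> M"
      using mult_pos_pos[OF r(1) S] by (simp add: zero_le_mult_iff del: of_nat_0_less_iff)
    moreover have "regular_hypergraph V E" if "M = b"
    proof -
      have "(\<Sum>i\<in>V. real (hdegree E i) * D i) = 0"
        using key \<open>0 \<le> (\<Sum>i\<in>V. real (hdegree E i) * D i)\<close> that by simp
      then have zero: "hdegree E i = 0 \<or> D i = 0" if "i \<in> V" for i
        using that finite_V D(1) by (simp add: sum_nonneg_eq_0_iff)
      have "hdegree E i = hdegree E j" if ij: "i \<in> V" "j \<in> V" for i j
      proof (cases "i = j")
        case False
        then have "D i = 0" "D j = 0"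
          using ij zero[of i] zero[of j] degree_pos[of i j] degree_pos[of j i] by simp_all
        then have "y i = s" "y j = s"
          by (simp_all only: D(2))
        then have "real (hdegree E i) = real (hdegree E j)"
          using yr1[of i] yr1[of j] by simp
        then show ?thesis by simp
      qed simp
      then show ?thesis
        unfolding regular_hypergraph_def by blast
    qed
    ultimately show ?thesis by blast
  qed
  then show "b \<le> M" and "M = b \<Longrightarrow> regular_hypergraph V E"
    by simp_all
qed

end

subsection \<open>The spectral radius\<close>

text \<open>Lets a real eigenvector serve in the definition of eigenvalues, which ranges over
  complex vectors.\<close>

lemma signless_laplacian_map_of_real:
  "signless_laplacian_map r E (\<lambda>i. complex_of_real (x i)) i =
    complex_of_real (signless_laplacian_map r E x i)"
  by (simp add: signless_laplacian_map_def)

lemma signless_laplacian_map_one: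
  "signless_laplacian_map r E (\<lambda>i. 1) i = 2 * of_nat (hdegree E i)"
  by (simp add: signless_laplacian_map_def hdegree_def mult_2)

text \<open>The eigenvalue of any positive eigenvector is attained and dominates every modulus. This
  serves both the maximizer and, for regular hypergraphs, the constant vector.\<close>

lemma tensor_spectral_radius_signless_laplacian:
  fixes v :: "nat \<Rightarrow> real"
  assumes "connected_uniform_hypergraph {1..n} E r"
    and pos: "\<And>i. i \<in> {1..n} \<Longrightarrow> 0 < v i"
    and v: "\<And>i. i \<in> {1..n} \<Longrightarrow> signless_laplacian_map r E v i = M * v i ^ (r - 1)"
  shows "tensor_spectral_radius r n (signless_laplacian_tensor r E) = M"
proof -
  interpret connected_uniform_hypergraph "{1..n}" E r by fact
  have apply_eq: "tensor_apply r n (signless_laplacian_tensor r E) x i = signless_laplacian_map r E x i"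
    if "i \<in> {1..n}" for x i
    using tensor_apply_signless_laplacian[OF hypergraph uniform that] rank by simp
  obtain a where a: "a \<in> {1..n}"
    using nonempty by blast
  show ?thesis
    unfolding tensor_spectral_radius_def
  proof (rule Greatest_equality)
    have "tensor_eigenvalue r n (signless_laplacian_tensor r E) (complex_of_real M)"
      unfolding tensor_eigenvalue_def
    proof (intro exI[of _ "\<lambda>i. complex_of_real (v i)"] conjI ballI)
      show "\<exists>i\<in>{1..n}. complex_of_real (v i) \<noteq> 0"
        using a pos[OF a] by (intro bexI[of _ a]) auto
    qed (simp add: apply_eq signless_laplacian_map_of_real v del: atLeastAtMost_iff)
    moreover have "M = cmod (complex_of_real M)"
      using positive_eigenvalue_nonneg[OF pos v] by simp
    ultimately show "\<exists>\<mu>. tensor_eigenvalue r n (signless_laplacian_tensor r E) \<mu> \<and> M = cmod \<mu>"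
      by blast
  next
    fix m assume "\<exists>\<mu>. tensor_eigenvalue r n (signless_laplacian_tensor r E) \<mu> \<and> m = cmod \<mu>"
    then obtain \<mu> x b where m: "m = cmod \<mu>" and b: "b \<in> {1..n}" "x b \<noteq> 0"
      and x: "\<And>i. i \<in> {1..n} \<Longrightarrow> tensor_apply r n (signless_laplacian_tensor r E) x i = \<mu> * x i ^ (r - 1)"
      unfolding tensor_eigenvalue_def by blast
    have eq: "signless_laplacian_map r E x i = \<mu> * x i ^ (r - 1)" if "i \<in> {1..n}" for i
      using x[OF that] apply_eq[OF that] by simp
    show "m \<le> M"
      unfolding m by (rule eigenvalue_le_positive_eigenvalue[of v M x \<mu> b, OF pos v eq b])
  qed
qed

theorem theorem1p2:
  fixes r n :: nat and E :: "nat set set"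
  assumes "r \<ge> 3" and "n \<ge> 1"
    and "hypergraph {1..n} E"
    and "uniform_hypergraph r E"
    and "connected_hypergraph {1..n} E"
  shows "tensor_spectral_radius r n (signless_laplacian_tensor r E)
           \<ge> 2 * (1 / real n * (\<Sum>i=1..n. real (hdegree E i) powr (real r / (real r - 1))))
                  powr ((real r - 1) / real r)
       \<and> (tensor_spectral_radius r n (signless_laplacian_tensor r E)
           = 2 * (1 / real n * (\<Sum>i=1..n. real (hdegree E i) powr (real r / (real r - 1))))
                  powr ((real r - 1) / real r)
          \<longleftrightarrow> regular_hypergraph {1..n} E)"
proof -
  have H: "connected_uniform_hypergraph {1..n} E r"
    using assms by unfold_locales auto
  interpret connected_uniform_hypergraph "{1..n}" E r by (rule H)
  let ?\<rho> = "tensor_spectral_radius r n (signless_laplacian_tensor r E)"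
  let ?b = "2 * (1 / real n * (\<Sum>i=1..n. real (hdegree E i) powr (real r / (real r - 1))))
      powr ((real r - 1) / real r)"
  obtain v :: "nat \<Rightarrow> real" and M where pos: "\<And>i. i \<in> {1..n} \<Longrightarrow> 0 < v i"
    and v: "\<And>i. i \<in> {1..n} \<Longrightarrow> signless_laplacian_map r E v i = M * v i ^ (r - 1)"
    using exists_positive_eigenvector by metis
  have \<rho>: "?\<rho> = M"
    by (rule tensor_spectral_radius_signless_laplacian[OF H pos v])
  have "?\<rho> = ?b" if reg: "regular_hypergraph {1..n} E"
  proof -
    define d where "d = hdegree E 1"
    have d: "hdegree E i = d" if "i \<in> {1..n}" for i
    proof -
      have "1 \<in> {1..n}"
        using assms(2) by simp
      with reg that show ?thesis
        unfolding regular_hypergraph_def d_def by blast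
    qed
    \<comment> \<open>The all-ones vector is a positive eigenvector: the diagonal and the
      \<open>d\<close> incident edges each contribute \<open>d\<close>.\<close>
    have "?\<rho> = 2 * real d"
    proof (rule tensor_spectral_radius_signless_laplacian[OF H])
      fix i assume "i \<in> {1..n}"
      then show "signless_laplacian_map r E (\<lambda>i. 1) i = 2 * real d * 1 ^ (r - 1)"
        by (simp add: signless_laplacian_map_one d del: atLeastAtMost_iff)
    qed simp
    moreover have "(\<Sum>i=1..n. real (hdegree E i) powr (real r / (real r - 1))) =
        real n * real d powr (real r / (real r - 1))"
      by (simp add: d del: atLeastAtMost_iff)
    moreover have "(real d powr (real r / (real r - 1))) powr ((real r - 1) / real r) = real d"
      using assms(1) by (simp add: powr_powr)
    ultimately show ?thesis
      using assms(2) by simp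
  qed
  moreover have "?b \<le> ?\<rho>" "?\<rho> = ?b \<Longrightarrow> regular_hypergraph {1..n} E"
    using degree_power_mean_le[OF pos v] unfolding \<rho> by simp_all
  ultimately show ?thesis by blast
qed

end
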